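(* Let $m\geq 2$ be an integer and $A=\{0,a,m\}$ with $0<a<m$ and $\gcd(a,m)=1$. Then for all integers $h,t\geq 1$, $$(hA)^{(t)}=[hm]\setminus\big(\mathcal{E}_t(A)\cup(hm-\mathcal{E}_t(m-A))\big).$$
   Context: For an integer $N\ge 0$, $[N]:=\{0,1,\ldots,N\}$. For a set $X$ of integers and an integer $N$, $N-X:=\{N-x : x\in X\}$. For a finite set $A$ of non-negative integers with $\min A=0$, maximum $m$ and $\gcd(A)=1$, and integers $h,t\geq 1$, $r_{A,h}(n)$ is the number of $(k_a)_{a\in A}\in\mathbb{Z}_{\geq 0}^{A}$ with $\sum_{a\in A}k_a a=n$ and $\sum_{a\in A}k_a=h$; $(hA)^{(t)}:=\{n\in\mathbb{Z}_{\geq 0} : r_{A,h}(n)\geq t\}$; $\mathcal{P}_t(A):=\bigcup_{h\geq 1}(hA)^{(t)}$; $\mathcal{E}_t(A):=\mathbb{Z}_{\geq 0}\setminus\mathcal{P}_t(A)$. The same definitions are applied to $m-A$. *)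

theory Defs
  imports Complex_Main "HOL-Library.FuncSet"
begin

text \<open>
  All sets are sets of integers, so that the reflection \<open>N - X\<close> below uses genuine (not truncated)
  subtraction. The parameter \<open>A\<close> is meant to be a finite set of non-negative integers.
\<close>

text \<open>
  Multiplicity functions live in \<open>A \<rightarrow>\<^sub>E UNIV\<close>, the extensional function space, so that two of them
  that agree on \<open>A\<close> are counted once.
\<close>

definition reps :: "int set \<Rightarrow> nat \<Rightarrow> int \<Rightarrow> (int \<Rightarrow> nat) set" where
  "reps A h n =
     {k \<in> A \<rightarrow>\<^sub>E UNIV. (\<Sum>a\<in>A. int (k a) * a) = n \<and> (\<Sum>a\<in>A. k a) = h}"

definition rep_count :: "int set \<Rightarrow> nat \<Rightarrow> int \<Rightarrow> nat" where
  "rep_count A h n = card (reps A h n)"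

text \<open>The cardinality above is never that of an infinite set when \<open>A\<close> is finite.\<close>

lemma finite_reps:
  assumes "finite A"
  shows "finite (reps A h n)"
proof (rule finite_subset)
  show "reps A h n \<subseteq> A \<rightarrow>\<^sub>E {..h}"
  proof
    fix k assume "k \<in> reps A h n"
    then have k: "k \<in> A \<rightarrow>\<^sub>E UNIV" and s: "(\<Sum>a\<in>A. k a) = h"
      by (auto simp: reps_def)
    have "k a \<le> h" if "a \<in> A" for a
      using member_le_sum[OF that, of k] assms s by simp
    with k show "k \<in> A \<rightarrow>\<^sub>E {..h}"
      by (auto simp: PiE_iff)
  qed
  show "finite (A \<rightarrow>\<^sub>E {..h})"
    using assms by (intro finite_PiE) auto
qed

text \<open>\<open>(hA)\<^sup>(\<^sup>t\<^sup>)\<close>, \<open>P\<^sub>t(A)\<close>, \<open>E\<^sub>t(A)\<close> and \<open>N - X\<close>, respectively.\<close>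

definition sumset_mult :: "nat \<Rightarrow> int set \<Rightarrow> nat \<Rightarrow> int set" where
  "sumset_mult h A t = {n. 0 \<le> n \<and> t \<le> rep_count A h n}"

definition represented :: "nat \<Rightarrow> int set \<Rightarrow> int set" where
  "represented t A = (\<Union>h\<in>{1..}. sumset_mult h A t)"

definition exceptional :: "nat \<Rightarrow> int set \<Rightarrow> int set" where
  "exceptional t A = {0..} - represented t A"

definition reflect :: "int \<Rightarrow> int set \<Rightarrow> int set" where
  "reflect N X = {N - x |x. x \<in> X}"

end

theory Submission
  imports Defs
begin

text \<open>
  For a fixed integer \<open>n\<close>, the integer solutions of \<open>x a + y m = n\<close> form one line
  \<open>(x\<^sub>0 + m s, y\<^sub>0 - a s)\<close>, where \<open>s\<close> ranges over the integers and \<open>0 \<le> x\<^sub>0 < m\<close>. Such a solution is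
  a representation of \<open>n\<close> by \<open>h\<close> summands from \<open>{0, a, m}\<close> exactly when all three multiplicities
  \<open>x\<close>, \<open>y\<close> and \<open>z = h - x - y\<close> are nonnegative. By the choice of \<open>x\<^sub>0\<close> the first one says \<open>s \<ge> 0\<close>.
  The other two are the upper bounds \<open>s a \<le> y\<^sub>0\<close> and \<open>s (m - a) \<le> z\<^sub>0\<close> with
  \<open>z\<^sub>0 = h - x\<^sub>0 - y\<^sub>0\<close>, so the admissible \<open>s\<close> form an initial segment of the naturals. Hence there are
  at least \<open>t\<close> representations if and only if \<open>s = t - 1\<close> is admissible, that is, if and only if

  \<open>(t - 1) a \<le> y\<^sub>0\<close> and \<open>(t - 1) (m - a) \<le> z\<^sub>0\<close>  (lemma \<open>le_rep_count_iff\<close>).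

  The theorem is the observation that these two inequalities have separate meanings. The second one
  holds for all large \<open>h\<close>, so the first one says that \<open>n\<close> is not exceptional for \<open>A\<close>
  (lemma \<open>mem_represented_iff\<close>). Exchanging the summands \<open>0\<close> and \<open>m\<close>, that is, passing from \<open>A\<close> to
  \<open>m - A\<close> and from \<open>n\<close> to \<open>h m - n\<close>, exchanges \<open>y\<^sub>0\<close> and \<open>z\<^sub>0\<close> and keeps \<open>x\<^sub>0\<close>, so the second
  inequality says that \<open>h m - n\<close> is not exceptional for \<open>m - A\<close>.
\<close>

lemma Suc_le_card_down_closed_iff:
  fixes S :: "nat set"
  assumes "finite S" and down: "\<And>i j. j \<in> S \<Longrightarrow> i \<le> j \<Longrightarrow> i \<in> S"
  shows "Suc j \<le> card S \<longleftrightarrow> j \<in> S"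
proof
  assume "j \<in> S"
  then have "{..j} \<subseteq> S" using down by auto
  from card_mono[OF \<open>finite S\<close> this] show "Suc j \<le> card S" by simp
next
  assume card: "Suc j \<le> card S"
  show "j \<in> S"
  proof (rule ccontr)
    assume "j \<notin> S"
    then have "S \<subseteq> {..<j}" using down by (meson lessThan_iff linorder_not_less subsetI)
    from card_mono[OF _ this] card show False by simp
  qed
qed

lemma coprime_normal_form:
  fixes b m n :: int
  assumes "0 < m" "coprime b m"
  obtains x y where "0 \<le> x" "x < m" "n = x * b + y * m"
proof -
  obtain u v where uv: "u * b + v * m = 1"
    using bezout_int[of b m] assms(2) by (auto simp: coprime_iff_gcd_eq_1)
  let ?q = "(n * u) div m"
  have "n = n * (u * b + v * m)" using uv by simp
  also have "\<dots> = (n * u) * b + n * v * m" by (simp add: algebra_simps)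
  also have "n * u = (n * u) mod m + ?q * m" by simp
  also have "\<dots> * b + n * v * m = ((n * u) mod m) * b + (?q * b + n * v) * m"
    by (simp only: algebra_simps)
  finally show thesis
    using that[of "(n * u) mod m"] assms(1) by simp
qed

lemma mem_reps_triple_iff:
  fixes b m :: int
  assumes "0 < b" "b < m"
  shows "k \<in> reps {0, b, m} h n \<longleftrightarrow>
    k \<in> {0, b, m} \<rightarrow>\<^sub>E UNIV \<and> int (k b) * b + int (k m) * m = n \<and> k 0 + k b + k m = h"
  using assms by (auto simp: reps_def)

text \<open>
  Moving one step along the line of solutions trades \<open>b\<close> summands \<open>m\<close>, together with \<open>m - b\<close>
  summands \<open>0\<close>, for \<open>m\<close> summands \<open>b\<close>. Since \<open>x < m\<close>, the starting point \<open>s = 0\<close> has the fewest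
  summands \<open>b\<close> among all points of the line where their number is nonnegative. The integers \<open>y\<close> and
  \<open>h - x - y\<close> may be negative, in which case the two sets in bijection are empty.
\<close>
lemma bij_betw_reps_triple:
  fixes b m n x y :: int
  assumes b: "0 < b" "b < m" and cop: "coprime b m"
    and x: "0 \<le> x" "x < m" and n: "n = x * b + y * m"
  shows "bij_betw
    (\<lambda>s. \<lambda>c\<in>{0, b, m}. if c = 0 then nat (int h - x - y - int s * (m - b))
                      else if c = b then nat (x + int s * m) else nat (y - int s * b))
    {s. int s * b \<le> y \<and> int s * (m - b) \<le> int h - x - y} (reps {0, b, m} h n)"
    (is "bij_betw ?f ?S ?R")
proof (rule bij_betw_imageI)
  show "inj_on ?f ?S"
  proof (rule inj_onI)
    fix s s' assume "?f s = ?f s'"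
    then have "?f s b = ?f s' b" by (rule fun_cong)
    then have "nat (x + int s * m) = nat (x + int s' * m)" using b by simp
    then have "int s * m = int s' * m" using b x by (simp add: eq_nat_nat_iff)
    then show "s = s'" using b by simp
  qed
  show "?f ` ?S = ?R"
  proof (intro equalityI subsetI)
    fix k assume "k \<in> ?f ` ?S"
    then obtain s where s: "int s * b \<le> y" "int s * (m - b) \<le> int h - x - y" and k: "k = ?f s"
      by auto
    have vals: "int (k 0) = int h - x - y - int s * (m - b)" "int (k b) = x + int s * m"
      "int (k m) = y - int s * b"
      using s b x unfolding k by simp_all
    have "int (k b) * b + int (k m) * m = n"
      unfolding vals n by (simp add: algebra_simps)
    moreover have "int (k 0 + k b + k m) = int h"
      unfolding of_nat_add vals by (simp add: algebra_simps)
    then have "k 0 + k b + k m = h" by linarith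
    moreover have "k \<in> {0, b, m} \<rightarrow>\<^sub>E UNIV" unfolding k by simp
    ultimately show "k \<in> ?R" using mem_reps_triple_iff[OF b] by blast
  next
    fix k assume "k \<in> ?R"
    then have ext: "k \<in> {0, b, m} \<rightarrow>\<^sub>E UNIV"
      and val: "int (k b) * b + int (k m) * m = n" and len: "k 0 + k b + k m = h"
      using mem_reps_triple_iff[OF b] by blast+
    have eq: "(int (k b) - x) * b = m * (y - int (k m))"
      using val n by (simp add: algebra_simps)
    then have "m dvd (int (k b) - x) * b" by simp
    then have "m dvd int (k b) - x"
      using cop by (simp add: coprime_dvd_mult_left_iff coprime_commute)
    then obtain q where q: "int (k b) - x = m * q" by blast
    have "q \<ge> 0"
    proof (rule ccontr)
      assume "\<not> q \<ge> 0"
      then have "m * q \<le> m * (-1)" using b by (intro mult_left_mono) auto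
      then show False using q x by linarith
    qed
    then obtain s where s: "q = int s" using nonneg_int_cases by blast
    have kb: "int (k b) = x + int s * m" using q s by (simp add: algebra_simps)
    have "m * (int s * b) = m * (y - int (k m))" using eq q s by (simp add: algebra_simps)
    then have km: "int (k m) = y - int s * b" using b by simp
    have k0: "int (k 0) = int h - x - y - int s * (m - b)"
      using len kb km by (simp add: algebra_simps flip: len)
    have "s \<in> ?S" using km k0 by simp
    moreover have "k = ?f s"
    proof (rule extensionalityI[where A = "{0, b, m}"])
      show "k \<in> extensional {0, b, m}" using ext by (simp add: PiE_def)
      show "?f s \<in> extensional {0, b, m}" by simp
      show "k c = ?f s c" if "c \<in> {0, b, m}" for c
        using that b by (auto simp flip: kb km k0)
    qed
    ultimately show "k \<in> ?f ` ?S" by blast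
  qed
qed

lemma le_rep_count_iff:
  fixes b m n x y :: int
  assumes b: "0 < b" "b < m" and cop: "coprime b m"
    and x: "0 \<le> x" "x < m" and n: "n = x * b + y * m" and t: "t \<ge> 1"
  shows "t \<le> rep_count {0, b, m} h n \<longleftrightarrow>
    int (t - 1) * b \<le> y \<and> int (t - 1) * (m - b) \<le> int h - x - y"
proof -
  let ?S = "{s. int s * b \<le> y \<and> int s * (m - b) \<le> int h - x - y}"
  have bij: "bij_betw (\<lambda>s. \<lambda>c\<in>{0, b, m}. if c = 0 then nat (int h - x - y - int s * (m - b))
      else if c = b then nat (x + int s * m) else nat (y - int s * b)) ?S (reps {0, b, m} h n)"
    by (rule bij_betw_reps_triple) fact+
  then have card: "rep_count {0, b, m} h n = card ?S"
    by (simp add: rep_count_def bij_betw_same_card)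
  have "finite ?S"
    using bij_betw_finite[OF bij] by (simp add: finite_reps)
  moreover have "i \<in> ?S" if "j \<in> ?S" "i \<le> j" for i j
  proof -
    have "int i * b \<le> int j * b" "int i * (m - b) \<le> int j * (m - b)"
      using that b by (intro mult_right_mono; simp)+
    with that show ?thesis by simp
  qed
  ultimately have "Suc (t - 1) \<le> card ?S \<longleftrightarrow> t - 1 \<in> ?S"
    by (rule Suc_le_card_down_closed_iff)
  with t show ?thesis by (simp add: card)
qed

lemma mem_represented_iff:
  fixes b m n x y :: int
  assumes b: "0 < b" "b < m" and cop: "coprime b m"
    and x: "0 \<le> x" "x < m" and n: "n = x * b + y * m" and t: "t \<ge> 1"
  shows "n \<in> represented t {0, b, m} \<longleftrightarrow> 0 \<le> n \<and> int (t - 1) * b \<le> y"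
proof
  assume "n \<in> represented t {0, b, m}"
  then show "0 \<le> n \<and> int (t - 1) * b \<le> y"
    using le_rep_count_iff[OF assms] by (auto simp: represented_def sumset_mult_def)
next
  assume n0: "0 \<le> n \<and> int (t - 1) * b \<le> y"
  define h where "h = Suc (nat (x + y + int (t - 1) * (m - b)))"
  have "int (t - 1) * (m - b) \<le> int h - x - y" unfolding h_def by linarith
  with n0 have "n \<in> sumset_mult h {0, b, m} t"
    using le_rep_count_iff[OF assms, of h] by (simp add: sumset_mult_def)
  moreover have "h \<in> {1..}" unfolding h_def by simp
  ultimately show "n \<in> represented t {0, b, m}" unfolding represented_def by blast
qed

lemma reflect_triple: "reflect m {0, a, m} = {0, m - a, m}"
  by (auto simp: reflect_def)

lemma mem_reflect_iff: "n \<in> reflect N X \<longleftrightarrow> N - n \<in> X"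
  by (force simp: reflect_def)

theorem theoremA4:
  fixes m a :: int and A :: "int set" and h t :: nat
  assumes "m \<ge> 2"
    and "0 < a" and "a < m"
    and "gcd a m = 1"
    and "A = {0, a, m}"
    and "h \<ge> 1" and "t \<ge> 1"
  shows "sumset_mult h A t =
    {0..int h * m} - (exceptional t A \<union> reflect (int h * m) (exceptional t (reflect m A)))"
proof (rule set_eqI)
  fix n
  have a: "0 < a" "a < m" and cop: "coprime a m"
    using assms by (simp_all add: coprime_iff_gcd_eq_1)
  have a': "0 < m - a" "m - a < m" and cop': "coprime (m - a) m"
    using a cop by (simp_all add: coprime_iff_gcd_eq_1 gcd_diff2)
  obtain x y where x: "0 \<le> x" "x < m" and n: "n = x * a + y * m"
    using coprime_normal_form[OF _ cop] a by (metis order.strict_trans)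
  have n': "int h * m - n = x * (m - a) + (int h - x - y) * m"
    using n by (simp add: algebra_simps)
  note count = le_rep_count_iff[OF a cop x n \<open>t \<ge> 1\<close>, of h]
  note left = mem_represented_iff[OF a cop x n \<open>t \<ge> 1\<close>]
  note right = mem_represented_iff[OF a' cop' x n' \<open>t \<ge> 1\<close>]
  have upper: "n \<le> int h * m" if "int (t - 1) * (m - a) \<le> int h - x - y"
  proof -
    have "0 \<le> int (t - 1) * (m - a)" using a by simp
    with that have "0 \<le> int h - x - y" by linarith
    then have "0 \<le> (int h - x - y) * m" using a by simp
    moreover have "0 \<le> x * (m - a)" using x a by simp
    ultimately show ?thesis using n' by linarith
  qed
  have "n \<in> sumset_mult h A t \<longleftrightarrow> 0 \<le> n \<and> n \<le> int h * m \<and>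
      n \<in> represented t A \<and> int h * m - n \<in> represented t (reflect m A)"
    using count left right upper by (auto simp: sumset_mult_def assms(5) reflect_triple)
  then show "n \<in> sumset_mult h A t \<longleftrightarrow> n \<in> {0..int h * m} -
      (exceptional t A \<union> reflect (int h * m) (exceptional t (reflect m A)))"
    by (auto simp: exceptional_def mem_reflect_iff)
qed

end
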